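(* Let $\mathsf{K}$ be a small $\mathsf{DCpo}^\vee$-enriched category. For all objects $X,Y$ of $\mathsf{K}$, the map $\Theta_{X,Y}:\widehat{\mathsf{K}}(\widehat{X},\widehat{Y})\to\mathsf{K}(X,Y)$, $\Theta(f)=f_Y(id_Y)$, is left adjoint (as a monotone map between posets) to the hom-restriction $\widehat{(-)}:\mathsf{K}(X,Y)\to\widehat{\mathsf{K}}(\widehat{X},\widehat{Y})$. Hence the functor $\widehat{(-)}:\mathsf{K}\to\widehat{\mathsf{K}}$ is a locally reflective embedding.
   Context: $\mathsf{DCpo}^\vee$: posets with directed suprema and binary joins, Scott-continuous maps, pointwise order; $\mathsf{DCpo}^\vee$-enriched means hom-sets are such posets and composition is monotone and preserves directed suprema in each variable. $\widetilde{\mathsf{K}}$ is the category of lax functors $\mathsf{K}\to\mathsf{DCpo}^\vee$ and oplax transformations ($f_{X'}\circ\pi(g)\leq\pi'(g)\circ f_X$), ordered pointwise. For $X\in\mathsf{K}$, $\widehat{X}=\mathsf{K}(X,-):\mathsf{K}\to\mathsf{DCpo}^\vee$ (sending $g:Y\to Y'$ to $h\mapsto g\circ h$); for $f:X\to X'$ in $\mathsf{K}$, $\widehat{f}=\mathsf{K}(f,-):\widehat{X'}\to\widehat{X}$ with components $h\mapsto h\circ f$. $\widehat{\mathsf{K}}$ is the full subcategory of $\widetilde{\mathsf{K}}^{op}$ on the objects $\widehat{X}$, so $\widehat{\mathsf{K}}(\widehat{X},\widehat{Y})=\widetilde{\mathsf{K}}(\widehat{Y},\widehat{X})$ and $\widehat{f}$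 is a morphism $\widehat{X}\to\widehat{X'}$ of $\widehat{\mathsf{K}}$; this gives a locally monotonic functor $\widehat{(-)}:\mathsf{K}\to\widehat{\mathsf{K}}$. For $f\in\widetilde{\mathsf{K}}(\widehat{Y},\widehat{X})$, $f_Y:\mathsf{K}(Y,Y)\to\mathsf{K}(X,Y)$. A locally monotonic faithful functor $F$ is locally reflective (a locally reflective embedding) if each hom-restriction $F_{X,Y}$, viewed as a monotone map of posets, has a left adjoint. *)

theory Defs
  imports "HOL-Algebra.Galois_Connection" "HOL-Library.FuncSet"
begin

section \<open>Posets with directed suprema and binary joins\<close>

definition directed :: "('a, 'c) gorder_scheme \<Rightarrow> 'a set \<Rightarrow> bool" where
  "directed L D \<longleftrightarrow> D \<subseteq> carrier L \<and> D \<noteq> {} \<and>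
     (\<forall>x\<in>D. \<forall>y\<in>D. \<exists>z\<in>D. x \<sqsubseteq>\<^bsub>L\<^esub> z \<and> y \<sqsubseteq>\<^bsub>L\<^esub> z)"

text \<open>Binary joins come from \<^locale>\<open>upper_semilattice\<close>.
  A bottom element is not required, and the carrier may be empty.\<close>

locale dcpo_join = upper_semilattice L for L (structure) +
  assumes directed_sup_exists: "directed L D \<Longrightarrow> \<exists>s. is_lub L s D"

definition scott_continuous ::
    "('a, 'c) gorder_scheme \<Rightarrow> ('b, 'd) gorder_scheme \<Rightarrow> ('a \<Rightarrow> 'b) \<Rightarrow> bool" where
  "scott_continuous L M f \<longleftrightarrow> f \<in> carrier L \<rightarrow> carrier M \<and> isotone L M f \<and>
     (\<forall>D s. directed L D \<longrightarrow> is_lub L s D \<longrightarrow> is_lub M (f s) (f ` D))"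


section \<open>Order-enriched categories\<close>

text \<open>As usual for enriched categories, hom-posets are indexed by pairs of objects and are not
  assumed disjoint; identity and composition therefore carry the objects as arguments:
  \<open>cmp C X Y Z g f\<close> is \<open>g \<circ> f\<close> for \<open>f : X \<rightarrow> Y\<close> and \<open>g : Y \<rightarrow> Z\<close>.
  Objects and arrows form sets, so every such category is small relative to HOL.\<close>

record ('o, 'm) ocat =
  obj :: "'o set"
  hom_poset :: "'o \<Rightarrow> 'o \<Rightarrow> 'm gorder"
  idt :: "'o \<Rightarrow> 'm"
  cmp :: "'o \<Rightarrow> 'o \<Rightarrow> 'o \<Rightarrow> 'm \<Rightarrow> 'm \<Rightarrow> 'm"

abbreviation arr :: "('o, 'm) ocat \<Rightarrow> 'o \<Rightarrow> 'o \<Rightarrow> 'm set" where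
  "arr C X Y \<equiv> carrier (hom_poset C X Y)"

abbreviation arr_le :: "('o, 'm) ocat \<Rightarrow> 'o \<Rightarrow> 'o \<Rightarrow> 'm \<Rightarrow> 'm \<Rightarrow> bool" where
  "arr_le C X Y \<equiv> le (hom_poset C X Y)"

locale order_category =
  fixes C :: "('o, 'm) ocat"
  assumes hom_partial_order:
      "\<lbrakk>X \<in> obj C; Y \<in> obj C\<rbrakk> \<Longrightarrow> partial_order (hom_poset C X Y)"
    and idt_closed: "X \<in> obj C \<Longrightarrow> idt C X \<in> arr C X X"
    and cmp_closed:
      "\<lbrakk>X \<in> obj C; Y \<in> obj C; Z \<in> obj C; f \<in> arr C X Y; g \<in> arr C Y Z\<rbrakk>
        \<Longrightarrow> cmp C X Y Z g f \<in> arr C X Z"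
    and cmp_idt_right:
      "\<lbrakk>X \<in> obj C; Y \<in> obj C; f \<in> arr C X Y\<rbrakk> \<Longrightarrow> cmp C X X Y f (idt C X) = f"
    and cmp_idt_left:
      "\<lbrakk>X \<in> obj C; Y \<in> obj C; f \<in> arr C X Y\<rbrakk> \<Longrightarrow> cmp C X Y Y (idt C Y) f = f"
    and cmp_assoc:
      "\<lbrakk>W \<in> obj C; X \<in> obj C; Y \<in> obj C; Z \<in> obj C;
        f \<in> arr C W X; g \<in> arr C X Y; h \<in> arr C Y Z\<rbrakk>
        \<Longrightarrow> cmp C W X Z (cmp C X Y Z h g) f = cmp C W Y Z h (cmp C W X Y g f)"
    and cmp_mono:
      "\<lbrakk>X \<in> obj C; Y \<in> obj C; Z \<in> obj C; f \<in> arr C X Y; f' \<in> arr C X Y;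
        g \<in> arr C Y Z; g' \<in> arr C Y Z; arr_le C X Y f f'; arr_le C Y Z g g'\<rbrakk>
        \<Longrightarrow> arr_le C X Z (cmp C X Y Z g f) (cmp C X Y Z g' f')"

locale dcpo_join_category = order_category C for C :: "('o, 'm) ocat" +
  assumes hom_dcpo_join:
      "\<lbrakk>X \<in> obj C; Y \<in> obj C\<rbrakk> \<Longrightarrow> dcpo_join (hom_poset C X Y)"
    and cmp_continuous_right:
      "\<lbrakk>X \<in> obj C; Y \<in> obj C; Z \<in> obj C; g \<in> arr C Y Z\<rbrakk>
        \<Longrightarrow> scott_continuous (hom_poset C X Y) (hom_poset C X Z) (\<lambda>f. cmp C X Y Z g f)"
    and cmp_continuous_left:
      "\<lbrakk>X \<in> obj C; Y \<in> obj C; Z \<in> obj C; f \<in> arr C X Y\<rbrakk>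
        \<Longrightarrow> scott_continuous (hom_poset C Y Z) (hom_poset C X Z) (\<lambda>g. cmp C X Y Z g f)"

text \<open>Opposite: 1-cells are reversed, the order on hom-sets is kept.\<close>

definition op_cat :: "('o, 'm) ocat \<Rightarrow> ('o, 'm) ocat" where
  "op_cat C = \<lparr>obj = obj C,
     hom_poset = (\<lambda>X Y. hom_poset C Y X),
     idt = idt C,
     cmp = (\<lambda>X Y Z g f. cmp C Z Y X f g)\<rparr>"

definition full_subcat :: "('o, 'm) ocat \<Rightarrow> 'o set \<Rightarrow> ('o, 'm) ocat" where
  "full_subcat C S = C\<lparr>obj := S \<inter> obj C\<rparr>"

text \<open>The category of all posets with directed suprema and binary joins whose carrier
  is a subset of the type \<open>'a\<close>, with Scott-continuous maps ordered pointwise.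
  Maps are extensional outside the carrier so that equality is equality of maps.\<close>

definition DCpoV :: "('a gorder, 'a \<Rightarrow> 'a) ocat" where
  "DCpoV = \<lparr>obj = {L. dcpo_join L},
     hom_poset = (\<lambda>L M. \<lparr>carrier = {f \<in> extensional (carrier L). scott_continuous L M f},
                          eq = (=),
                          le = (\<lambda>f g. \<forall>x\<in>carrier L. f x \<sqsubseteq>\<^bsub>M\<^esub> g x)\<rparr>),
     idt = (\<lambda>L. \<lambda>x\<in>carrier L. x),
     cmp = (\<lambda>L M N g f. compose (carrier L) g f)\<rparr>"


section \<open>Functors, lax functors and oplax transformations\<close>

record ('o, 'm, 'p, 'n) ofun =
  on_obj :: "'o \<Rightarrow> 'p"
  on_arr :: "'o \<Rightarrow> 'o \<Rightarrow> 'm \<Rightarrow> 'n"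

locale locally_monotone =
  C: order_category C + D: order_category D
  for C :: "('o, 'm) ocat" and D :: "('p, 'n) ocat" and F :: "('o, 'm, 'p, 'n) ofun" +
  assumes on_obj_closed: "on_obj F \<in> obj C \<rightarrow>\<^sub>E obj D"
    and on_arr_closed:
      "on_arr F \<in> (\<Pi>\<^sub>E X\<in>obj C. \<Pi>\<^sub>E Y\<in>obj C.
                     arr C X Y \<rightarrow>\<^sub>E arr D (on_obj F X) (on_obj F Y))"
    and on_arr_mono:
      "\<lbrakk>X \<in> obj C; Y \<in> obj C\<rbrakk> \<Longrightarrow>
        isotone (hom_poset C X Y) (hom_poset D (on_obj F X) (on_obj F Y)) (on_arr F X Y)"

locale lax_functor = locally_monotone C D F
  for C :: "('o, 'm) ocat" and D :: "('p, 'n) ocat" and F :: "('o, 'm, 'p, 'n) ofun" +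
  assumes lax_idt:
      "X \<in> obj C \<Longrightarrow>
        arr_le D (on_obj F X) (on_obj F X) (idt D (on_obj F X)) (on_arr F X X (idt C X))"
    and lax_cmp:
      "\<lbrakk>X \<in> obj C; Y \<in> obj C; Z \<in> obj C; f \<in> arr C X Y; g \<in> arr C Y Z\<rbrakk> \<Longrightarrow>
        arr_le D (on_obj F X) (on_obj F Z)
          (cmp D (on_obj F X) (on_obj F Y) (on_obj F Z) (on_arr F Y Z g) (on_arr F X Y f))
          (on_arr F X Z (cmp C X Y Z g f))"

locale locally_monotonic_functor = locally_monotone C D F
  for C :: "('o, 'm) ocat" and D :: "('p, 'n) ocat" and F :: "('o, 'm, 'p, 'n) ofun" +
  assumes functor_idt: "X \<in> obj C \<Longrightarrow> on_arr F X X (idt C X) = idt D (on_obj F X)"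
    and functor_cmp:
      "\<lbrakk>X \<in> obj C; Y \<in> obj C; Z \<in> obj C; f \<in> arr C X Y; g \<in> arr C Y Z\<rbrakk> \<Longrightarrow>
        on_arr F X Z (cmp C X Y Z g f) =
          cmp D (on_obj F X) (on_obj F Y) (on_obj F Z) (on_arr F Y Z g) (on_arr F X Y f)"

definition oplax_transformations ::
    "('o, 'm) ocat \<Rightarrow> ('p, 'n) ocat \<Rightarrow> ('o, 'm, 'p, 'n) ofun \<Rightarrow> ('o, 'm, 'p, 'n) ofun
      \<Rightarrow> ('o \<Rightarrow> 'n) set" where
  "oplax_transformations C D F G =
     {\<tau> \<in> (\<Pi>\<^sub>E X\<in>obj C. arr D (on_obj F X) (on_obj G X)).
        \<forall>X\<in>obj C. \<forall>Y\<in>obj C. \<forall>g\<in>arr C X Y.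
          arr_le D (on_obj F X) (on_obj G Y)
            (cmp D (on_obj F X) (on_obj F Y) (on_obj G Y) (\<tau> Y) (on_arr F X Y g))
            (cmp D (on_obj F X) (on_obj G X) (on_obj G Y) (on_arr G X Y g) (\<tau> X))}"

definition lax_functor_cat ::
    "('o, 'm) ocat \<Rightarrow> ('p, 'n) ocat \<Rightarrow> (('o, 'm, 'p, 'n) ofun, 'o \<Rightarrow> 'n) ocat" where
  "lax_functor_cat C D = \<lparr>obj = {F. lax_functor C D F},
     hom_poset = (\<lambda>F G.
       \<lparr>carrier = oplax_transformations C D F G,
        eq = (=),
        le = (\<lambda>\<tau> \<sigma>. \<forall>X\<in>obj C. arr_le D (on_obj F X) (on_obj G X) (\<tau> X) (\<sigma> X))\<rparr>),
     idt = (\<lambda>F. \<lambda>X\<in>obj C. idt D (on_obj F X)),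
     cmp = (\<lambda>F G H \<tau> \<sigma>. \<lambda>X\<in>obj C.
       cmp D (on_obj F X) (on_obj G X) (on_obj H X) (\<tau> X) (\<sigma> X))\<rparr>"


section \<open>Locally reflective embeddings\<close>

definition left_adjoint ::
    "'a gorder \<Rightarrow> 'b gorder \<Rightarrow> ('a \<Rightarrow> 'b) \<Rightarrow> ('b \<Rightarrow> 'a) \<Rightarrow> bool" where
  "left_adjoint A B l u \<longleftrightarrow>
     galois_connection \<lparr>orderA = A, orderB = B, lower = l, upper = u\<rparr>"

definition faithful ::
    "('o, 'm) ocat \<Rightarrow> ('o, 'm, 'p, 'n) ofun \<Rightarrow> bool" where
  "faithful C F \<longleftrightarrow> (\<forall>X\<in>obj C. \<forall>Y\<in>obj C. inj_on (on_arr F X Y) (arr C X Y))"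

definition locally_reflective_embedding ::
    "('o, 'm) ocat \<Rightarrow> ('p, 'n) ocat \<Rightarrow> ('o, 'm, 'p, 'n) ofun \<Rightarrow> bool" where
  "locally_reflective_embedding C D F \<longleftrightarrow>
     locally_monotonic_functor C D F \<and> faithful C F \<and>
     (\<forall>X\<in>obj C. \<forall>Y\<in>obj C. \<exists>l.
        left_adjoint (hom_poset D (on_obj F X) (on_obj F Y)) (hom_poset C X Y)
          l (on_arr F X Y))"


section \<open>The category of representables\<close>

definition tilde_cat ::
    "('o, 'm) ocat \<Rightarrow> (('o, 'm, 'm gorder, 'm \<Rightarrow> 'm) ofun, 'o \<Rightarrow> 'm \<Rightarrow> 'm) ocat" where
  "tilde_cat K = lax_functor_cat K DCpoV"

definition hat_obj ::
    "('o, 'm) ocat \<Rightarrow> 'o \<Rightarrow> ('o, 'm, 'm gorder, 'm \<Rightarrow> 'm) ofun" where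
  "hat_obj K X = \<lparr>on_obj = (\<lambda>Y\<in>obj K. hom_poset K X Y),
     on_arr = (\<lambda>Y\<in>obj K. \<lambda>Y'\<in>obj K. \<lambda>g\<in>arr K Y Y'. \<lambda>h\<in>arr K X Y. cmp K X Y Y' g h)\<rparr>"

text \<open>For \<open>f : X \<rightarrow> X'\<close>, the transformation \<open>K(f,-) : K(X',-) \<Rightarrow> K(X,-)\<close>.\<close>

definition hat_arr ::
    "('o, 'm) ocat \<Rightarrow> 'o \<Rightarrow> 'o \<Rightarrow> 'm \<Rightarrow> 'o \<Rightarrow> 'm \<Rightarrow> 'm" where
  "hat_arr K X X' f = (\<lambda>Z\<in>obj K. \<lambda>h\<in>arr K X' Z. cmp K X X' Z h f)"

definition hat_cat ::
    "('o, 'm) ocat \<Rightarrow> (('o, 'm, 'm gorder, 'm \<Rightarrow> 'm) ofun, 'o \<Rightarrow> 'm \<Rightarrow> 'm) ocat" where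
  "hat_cat K = full_subcat (op_cat (tilde_cat K)) (hat_obj K ` obj K)"

definition hat ::
    "('o, 'm) ocat \<Rightarrow>
      ('o, 'm, ('o, 'm, 'm gorder, 'm \<Rightarrow> 'm) ofun, 'o \<Rightarrow> 'm \<Rightarrow> 'm) ofun" where
  "hat K = \<lparr>on_obj = (\<lambda>X\<in>obj K. hat_obj K X),
     on_arr = (\<lambda>X\<in>obj K. \<lambda>X'\<in>obj K. \<lambda>f\<in>arr K X X'. hat_arr K X X' f)\<rparr>"

text \<open>\<open>\<Theta>\<close> on arrows from \<open>X\<close> to \<open>Y\<close>; the formula depends on \<open>Y\<close> only.\<close>

definition Theta :: "('o, 'm) ocat \<Rightarrow> 'o \<Rightarrow> 'o \<Rightarrow> ('o \<Rightarrow> 'm \<Rightarrow> 'm) \<Rightarrow> 'm" where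
  "Theta K X Y f = f Y (idt K Y)"

end

theory Submission
  imports Defs
begin

text \<open>A lax Yoneda lemma. For an oplax \<open>f : K(Y,-) \<Rightarrow> K(X,-)\<close> and \<open>h : Y \<rightarrow> Z\<close>, oplaxness at \<open>h\<close>
  evaluated at \<open>id\<^sub>Y\<close> gives \<open>f\<^sub>Z(h) \<le> h \<circ> f\<^sub>Y(id\<^sub>Y)\<close>. So \<open>f\<^sub>Y(id\<^sub>Y) \<le> g\<close> implies
  \<open>f\<^sub>Z(h) \<le> h \<circ> g\<close> for all \<open>Z\<close> and \<open>h\<close>, and the converse is the instance \<open>h = id\<^sub>Y\<close>. Faithfulness
  holds because \<open>g\<close> is recovered from \<open>K(g,-)\<close> by evaluation at \<open>id\<^sub>Y\<close>.\<close>

section \<open>Scott-continuous maps\<close>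

text \<open>With equality as the equivalence of the order record, the congruence axioms are
  automatic, so only reflexivity, antisymmetry and transitivity remain. The hom-posets of
  \<open>DCpoV\<close> and \<open>lax_functor_cat\<close> are records of this shape.\<close>

lemma partial_orderI:
  assumes "\<And>x. x \<in> A \<Longrightarrow> R x x"
    and "\<And>x y. \<lbrakk>x \<in> A; y \<in> A; R x y; R y x\<rbrakk> \<Longrightarrow> x = y"
    and "\<And>x y z. \<lbrakk>x \<in> A; y \<in> A; z \<in> A; R x y; R y z\<rbrakk> \<Longrightarrow> R x z"
  shows "partial_order \<lparr>carrier = A, eq = (=), le = R\<rparr>"
proof (unfold_locales, goal_cases)
  case (5 x y)
  then show ?case using assms(2) by simp
next
  case (6 x y z)
  then show ?case using assms(3)[of x y z] by simp
qed (simp_all add: assms(1))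

lemma (in partial_order) is_weak_partial_order: "weak_partial_order L"
  by unfold_locales

lemma scott_continuous_closed:
  "\<lbrakk>scott_continuous L M f; x \<in> carrier L\<rbrakk> \<Longrightarrow> f x \<in> carrier M"
  by (auto simp: scott_continuous_def)

lemma scott_continuous_mono:
  "\<lbrakk>scott_continuous L M f; x \<in> carrier L; y \<in> carrier L; x \<sqsubseteq>\<^bsub>L\<^esub> y\<rbrakk> \<Longrightarrow> f x \<sqsubseteq>\<^bsub>M\<^esub> f y"
  by (auto simp: scott_continuous_def isotone_def)

lemma is_lub_carrier: "is_lub L s D \<Longrightarrow> s \<in> carrier L"
  by (simp add: least_def Upper_def)

lemma directed_subset: "directed L D \<Longrightarrow> D \<subseteq> carrier L"
  by (simp add: directed_def)

text \<open>A directed set and its supremum lie in the carrier, so only the values there matter.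
  This allows maps to be made extensional, as the arrows of \<open>DCpoV\<close> must be.\<close>

lemma scott_continuous_cong:
  assumes f: "scott_continuous L M f" and eq: "\<And>x. x \<in> carrier L \<Longrightarrow> g x = f x"
  shows "scott_continuous L M g"
proof -
  have "is_lub M (g s) (g ` D)" if D: "directed L D" and s: "is_lub L s D" for D s
  proof -
    have "g ` D = f ` D"
      using directed_subset[OF D] eq by (intro image_cong) auto
    then show ?thesis
      using f D s eq[OF is_lub_carrier[OF s]] by (simp add: scott_continuous_def)
  qed
  then show ?thesis
    using f eq by (auto simp: scott_continuous_def isotone_def)
qed

lemma scott_continuous_restrict:
  "scott_continuous L M f \<Longrightarrow> scott_continuous L M (restrict f (carrier L))"
  by (erule scott_continuous_cong) simp

lemma scott_continuous_id: "weak_partial_order L \<Longrightarrow> scott_continuous L L (\<lambda>x. x)"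
  by (auto simp: scott_continuous_def isotone_def)

text \<open>Monotonicity carries an upper bound in \<open>D\<close> to one in the image. Composition
  relies on this, since continuity of the outer map speaks only of directed sets.\<close>

lemma directed_image:
  assumes f: "scott_continuous L M f" and D: "directed L D"
  shows "directed M (f ` D)"
proof -
  have sub: "D \<subseteq> carrier L" using D by (rule directed_subset)
  have "\<exists>z\<in>D. f x \<sqsubseteq>\<^bsub>M\<^esub> f z \<and> f y \<sqsubseteq>\<^bsub>M\<^esub> f z" if xy: "x \<in> D" "y \<in> D" for x y
  proof -
    obtain z where "z \<in> D" "x \<sqsubseteq>\<^bsub>L\<^esub> z" "y \<sqsubseteq>\<^bsub>L\<^esub> z"
      using D xy unfolding directed_def by blast
    with sub xy show ?thesis
      by (intro bexI[of _ z] conjI scott_continuous_mono[OF f]) auto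
  qed
  then show ?thesis
    using D sub scott_continuous_closed[OF f] unfolding directed_def by auto
qed

lemma scott_continuous_compose:
  assumes f: "scott_continuous L M f" and g: "scott_continuous M N g"
  shows "scott_continuous L N (\<lambda>x. g (f x))"
proof -
  have "is_lub N (g (f s)) ((\<lambda>x. g (f x)) ` D)" if D: "directed L D" and s: "is_lub L s D" for D s
  proof -
    have "is_lub M (f s) (f ` D)"
      using f D s by (simp add: scott_continuous_def)
    then have "is_lub N (g (f s)) (g ` f ` D)"
      using g directed_image[OF f D] by (simp add: scott_continuous_def)
    then show ?thesis by (simp add: image_image)
  qed
  then show ?thesis
    using f g by (auto simp: scott_continuous_def isotone_def Pi_iff)
qed

section \<open>Constructions on order-enriched categories\<close>

lemma DCpoV_simps [simp]:
  "obj DCpoV = {L. dcpo_join L}"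
  "arr DCpoV L M = {f \<in> extensional (carrier L). scott_continuous L M f}"
  "arr_le DCpoV L M f g \<longleftrightarrow> (\<forall>x\<in>carrier L. f x \<sqsubseteq>\<^bsub>M\<^esub> g x)"
  "idt DCpoV L = (\<lambda>x\<in>carrier L. x)"
  "cmp DCpoV L M N g f = compose (carrier L) g f"
  by (simp_all add: DCpoV_def)

lemma dcpo_join_partial_order: "dcpo_join L \<Longrightarrow> partial_order L"
  by (simp add: dcpo_join_def upper_semilattice_def)

text \<open>The laws are inherited pointwise from \<open>M\<close>; antisymmetry also uses that
  arrows are extensional, so that agreement on the carrier is equality.\<close>

lemma DCpoV_hom_partial_order:
  assumes "dcpo_join M"
  shows "partial_order (hom_poset DCpoV L M)"
proof -
  interpret M: partial_order M
    using assms by (rule dcpo_join_partial_order)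
  show ?thesis
    unfolding DCpoV_def ocat.simps
  proof (rule partial_orderI, goal_cases)
    case (1 f)
    then show ?case by (auto dest: scott_continuous_closed)
  next
    case (2 f g)
    then show ?case
      by (auto intro!: extensionalityI[of f "carrier L" g] dest: scott_continuous_closed)
  next
    case (3 f g h)
    then show ?case
      by (auto intro: M.le_trans dest: scott_continuous_closed)
  qed
qed

lemma order_category_DCpoV: "order_category DCpoV"
proof (rule order_category.intro, goal_cases)
  case (1 L M)
  then show ?case by (simp add: DCpoV_hom_partial_order)
next
  case (2 L)
  then have "partial_order L" by (simp add: dcpo_join_partial_order)
  then show ?case
    by (simp add: scott_continuous_restrict scott_continuous_id partial_order.is_weak_partial_order)
next
  case (3 L M N f g)
  then show ?case
    by (auto simp: compose_def intro!: scott_continuous_restrict intro: scott_continuous_compose)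
next
  case (4 L M f)
  then show ?case by (auto intro: compose_Id simp: scott_continuous_def)
next
  case (5 L M f)
  then show ?case by (auto intro: Id_compose simp: scott_continuous_def)
next
  case (6 J L M N f g h)
  then show ?case
    by (auto simp: compose_def fun_eq_iff scott_continuous_closed)
next
  case (7 L M N f f' g g')
  interpret N: partial_order N
    using 7 by (simp add: dcpo_join_partial_order)
  \<comment> \<open>The intermediate value is \<open>g (f' x)\<close>: monotonicity of
    \<open>g\<close> gives the first inequality, the pointwise order between \<open>g\<close> and
    \<open>g'\<close> the second.\<close>
  have "g (f x) \<sqsubseteq>\<^bsub>N\<^esub> g' (f' x)" if x: "x \<in> carrier L" for x
  proof (rule N.le_trans)
    show "g (f x) \<sqsubseteq>\<^bsub>N\<^esub> g (f' x)"
      using 7 x by (auto intro: scott_continuous_mono scott_continuous_closed)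
    show "g (f' x) \<sqsubseteq>\<^bsub>N\<^esub> g' (f' x)"
      using 7 x by (auto intro: scott_continuous_closed)
  qed (use 7 x in \<open>auto intro: scott_continuous_closed\<close>)
  then show ?case by (simp add: compose_eq)
qed

section \<open>Lax functors and oplax transformations\<close>

lemma lax_functor_cat_simps [simp]:
  "obj (lax_functor_cat C D) = {F. lax_functor C D F}"
  "arr (lax_functor_cat C D) F G = oplax_transformations C D F G"
  "arr_le (lax_functor_cat C D) F G \<tau> \<sigma> \<longleftrightarrow>
     (\<forall>X\<in>obj C. arr_le D (on_obj F X) (on_obj G X) (\<tau> X) (\<sigma> X))"
  "idt (lax_functor_cat C D) F = (\<lambda>X\<in>obj C. idt D (on_obj F X))"
  "cmp (lax_functor_cat C D) F G H \<tau> \<sigma> =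
     (\<lambda>X\<in>obj C. cmp D (on_obj F X) (on_obj G X) (on_obj H X) (\<tau> X) (\<sigma> X))"
  by (simp_all add: lax_functor_cat_def)

lemma oplax_transformation_closed:
  "\<lbrakk>\<tau> \<in> oplax_transformations C D F G; X \<in> obj C\<rbrakk> \<Longrightarrow> \<tau> X \<in> arr D (on_obj F X) (on_obj G X)"
  by (auto simp: oplax_transformations_def)

lemma oplax_transformation_extensional:
  "\<tau> \<in> oplax_transformations C D F G \<Longrightarrow> \<tau> \<in> extensional (obj C)"
  by (auto simp: oplax_transformations_def PiE_iff)

lemma oplax_transformation_le:
  "\<lbrakk>\<tau> \<in> oplax_transformations C D F G; X \<in> obj C; Y \<in> obj C; g \<in> arr C X Y\<rbrakk> \<Longrightarrow>
    arr_le D (on_obj F X) (on_obj G Y)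
      (cmp D (on_obj F X) (on_obj F Y) (on_obj G Y) (\<tau> Y) (on_arr F X Y g))
      (cmp D (on_obj F X) (on_obj G X) (on_obj G Y) (on_arr G X Y g) (\<tau> X))"
  by (auto simp: oplax_transformations_def)

lemma oplax_transformationI:
  assumes "\<And>X. X \<in> obj C \<Longrightarrow> \<tau> X \<in> arr D (on_obj F X) (on_obj G X)"
    and "\<tau> \<in> extensional (obj C)"
    and "\<And>X Y g. \<lbrakk>X \<in> obj C; Y \<in> obj C; g \<in> arr C X Y\<rbrakk> \<Longrightarrow>
      arr_le D (on_obj F X) (on_obj G Y)
        (cmp D (on_obj F X) (on_obj F Y) (on_obj G Y) (\<tau> Y) (on_arr F X Y g))
        (cmp D (on_obj F X) (on_obj G X) (on_obj G Y) (on_arr G X Y g) (\<tau> X))"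
  shows "\<tau> \<in> oplax_transformations C D F G"
  using assms by (auto simp: oplax_transformations_def PiE_iff)

context locally_monotone
begin

lemma on_obj_in: "X \<in> obj C \<Longrightarrow> on_obj F X \<in> obj D"
  using on_obj_closed by auto

lemma on_arr_in:
  assumes "X \<in> obj C" "Y \<in> obj C" "f \<in> arr C X Y"
  shows "on_arr F X Y f \<in> arr D (on_obj F X) (on_obj F Y)"
proof -
  have "on_arr F X \<in> (\<Pi>\<^sub>E Y\<in>obj C. arr C X Y \<rightarrow>\<^sub>E arr D (on_obj F X) (on_obj F Y))"
    using on_arr_closed assms(1) by (rule PiE_mem)
  then have "on_arr F X Y \<in> arr C X Y \<rightarrow>\<^sub>E arr D (on_obj F X) (on_obj F Y)"
    using assms(2) by (rule PiE_mem)
  then show ?thesis using assms(3) by (rule PiE_mem)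
qed

end

lemma (in order_category) hom_le_refl:
  assumes "X \<in> obj C" "Y \<in> obj C" "f \<in> arr C X Y"
  shows "arr_le C X Y f f"
proof -
  interpret partial_order "hom_poset C X Y" using assms(1,2) by (rule hom_partial_order)
  show ?thesis using assms(3) by (rule le_refl)
qed

lemma (in order_category) hom_le_trans:
  assumes "X \<in> obj C" "Y \<in> obj C"
    and "arr_le C X Y f g" "arr_le C X Y g h"
    and "f \<in> arr C X Y" "g \<in> arr C X Y" "h \<in> arr C X Y"
  shows "arr_le C X Y f h"
proof -
  interpret partial_order "hom_poset C X Y" using assms(1,2) by (rule hom_partial_order)
  show ?thesis using assms(3-) by (rule le_trans)
qed

lemma (in order_category) hom_le_antisym:
  assumes "X \<in> obj C" "Y \<in> obj C"
    and "arr_le C X Y f g" "arr_le C X Y g f"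
    and "f \<in> arr C X Y" "g \<in> arr C X Y"
  shows "f = g"
proof -
  interpret partial_order "hom_poset C X Y" using assms(1,2) by (rule hom_partial_order)
  show ?thesis using assms(3-) by (rule le_antisym)
qed

text \<open>By the unit laws of \<open>D\<close> both sides of the oplax square at \<open>g\<close>
  are \<open>on_arr F X Y g\<close>, so reflexivity suffices.\<close>

lemma oplax_transformation_idt:
  assumes "lax_functor C D F"
  shows "(\<lambda>X\<in>obj C. idt D (on_obj F X)) \<in> oplax_transformations C D F F"
proof -
  interpret lax_functor C D F by fact
  show ?thesis
    by (rule oplax_transformationI)
      (simp_all add: on_obj_in on_arr_in D.idt_closed D.cmp_idt_left D.cmp_idt_right D.hom_le_refl)
qed

text \<open>Two oplax squares are pasted: \<open>\<tau>_Y \<sigma>_Y F(g) \<le> \<tau>_Y G(g)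
  \<sigma>_X \<le> H(g) \<tau>_X \<sigma>_X\<close>. Each inequality is one square whiskered by a
  component of the other transformation; associativity matches the middle terms.\<close>

lemma oplax_transformation_cmp:
  assumes "lax_functor C D F" "lax_functor C D G" "lax_functor C D H"
    and \<sigma>: "\<sigma> \<in> oplax_transformations C D F G" and \<tau>: "\<tau> \<in> oplax_transformations C D G H"
  shows "(\<lambda>X\<in>obj C. cmp D (on_obj F X) (on_obj G X) (on_obj H X) (\<tau> X) (\<sigma> X))
    \<in> oplax_transformations C D F H"
proof -
  interpret F: lax_functor C D F by fact
  interpret G: lax_functor C D G by fact
  interpret H: lax_functor C D H by fact
  note closed = F.on_obj_in G.on_obj_in H.on_obj_in F.on_arr_in G.on_arr_in H.on_arr_in
    oplax_transformation_closed[OF \<sigma>] oplax_transformation_closed[OF \<tau>] F.D.cmp_closed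
  show ?thesis
  proof (rule oplax_transformationI, goal_cases)
    case (1 X)
    then show ?case by (simp add: closed)
  next
    case 2
    show ?case by simp
  next
    case (3 X Y g)
    let ?c = "cmp D (on_obj F X)"
    have "arr_le D (on_obj F X) (on_obj H Y)
        (?c (on_obj G Y) (on_obj H Y) (\<tau> Y) (?c (on_obj F Y) (on_obj G Y) (\<sigma> Y) (on_arr F X Y g)))
        (?c (on_obj G Y) (on_obj H Y) (\<tau> Y) (?c (on_obj G X) (on_obj G Y) (on_arr G X Y g) (\<sigma> X)))"
      using 3 by (intro F.D.cmp_mono oplax_transformation_le[OF \<sigma>] F.D.hom_le_refl closed)
    moreover have "arr_le D (on_obj F X) (on_obj H Y)
        (?c (on_obj G X) (on_obj H Y)
          (cmp D (on_obj G X) (on_obj G Y) (on_obj H Y) (\<tau> Y) (on_arr G X Y g)) (\<sigma> X))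
        (?c (on_obj G X) (on_obj H Y)
          (cmp D (on_obj G X) (on_obj H X) (on_obj H Y) (on_arr H X Y g) (\<tau> X)) (\<sigma> X))"
      using 3 by (intro F.D.cmp_mono oplax_transformation_le[OF \<tau>] F.D.hom_le_refl closed)
    ultimately show ?case
      using 3 F.D.hom_le_trans[of "on_obj F X" "on_obj H Y"]
      by (simp add: closed F.D.cmp_assoc)
  qed
qed

text \<open>All laws hold componentwise in \<open>D\<close>. Transformations are extensional on
  \<open>obj C\<close>, which turns equality of components into equality of transformations.\<close>

lemma order_category_lax_functor_cat:
  assumes "order_category C" "order_category D"
  shows "order_category (lax_functor_cat C D)"
proof -
  interpret D: order_category D by fact
  have on_obj: "on_obj F X \<in> obj D" if "lax_functor C D F" "X \<in> obj C" for F X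
    using that by (meson lax_functor_def locally_monotone.on_obj_in)
  note closed = on_obj oplax_transformation_closed
  have po: "partial_order (hom_poset (lax_functor_cat C D) F G)"
    if "lax_functor C D F" "lax_functor C D G" for F G
    unfolding lax_functor_cat_def ocat.simps
  proof (rule partial_orderI, goal_cases)
    case (1 \<tau>)
    then show ?case by (simp add: that closed D.hom_le_refl)
  next
    case (2 \<tau> \<sigma>)
    then show ?case
      by (intro extensionalityI[of \<tau> "obj C" \<sigma>])
        (auto intro: oplax_transformation_extensional D.hom_le_antisym closed that)
  next
    case (3 \<tau> \<sigma> \<rho>)
    show ?case
    proof
      fix X assume X: "X \<in> obj C"
      show "arr_le D (on_obj F X) (on_obj G X) (\<tau> X) (\<rho> X)"
        by (rule D.hom_le_trans[where g = "\<sigma> X"]) (use 3 X that in \<open>auto intro: closed\<close>)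
    qed
  qed
  show ?thesis
  proof (rule order_category.intro, goal_cases)
    case (1 F G)
    then show ?case by (simp add: po)
  next
    case (2 F)
    then show ?case by (simp add: oplax_transformation_idt)
  next
    case (3 F G H \<sigma> \<tau>)
    then show ?case by (simp add: oplax_transformation_cmp)
  next
    case (4 F G \<tau>)
    then show ?case
      by (intro extensionalityI[of _ "obj C"])
        (auto simp: closed D.cmp_idt_right intro: oplax_transformation_extensional)
  next
    case (5 F G \<tau>)
    then show ?case
      by (intro extensionalityI[of _ "obj C"])
        (auto simp: closed D.cmp_idt_left intro: oplax_transformation_extensional)
  next
    case (6 E F G H \<rho> \<sigma> \<tau>)
    then show ?case
      by (auto simp: fun_eq_iff closed D.cmp_assoc)
  next
    case (7 F G H \<sigma> \<sigma>' \<tau> \<tau>')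
    then show ?case by (auto intro!: D.cmp_mono closed)
  qed
qed

section \<open>Opposites and full subcategories\<close>

lemma op_cat_simps [simp]:
  "obj (op_cat C) = obj C"
  "hom_poset (op_cat C) X Y = hom_poset C Y X"
  "idt (op_cat C) = idt C"
  "cmp (op_cat C) X Y Z g f = cmp C Z Y X f g"
  by (simp_all add: op_cat_def)

lemma order_category_op_cat:
  assumes "order_category C"
  shows "order_category (op_cat C)"
proof -
  interpret order_category C by fact
  show ?thesis
    by (rule order_category.intro)
      (auto simp: hom_partial_order idt_closed cmp_closed cmp_idt_left cmp_idt_right cmp_assoc
        intro: cmp_mono)
qed

lemma full_subcat_simps [simp]:
  "obj (full_subcat C S) = S \<inter> obj C"
  "hom_poset (full_subcat C S) = hom_poset C"
  "idt (full_subcat C S) = idt C"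
  "cmp (full_subcat C S) = cmp C"
  by (simp_all add: full_subcat_def)

lemma order_category_full_subcat:
  assumes "order_category C"
  shows "order_category (full_subcat C S)"
proof -
  interpret order_category C by fact
  show ?thesis
    by (rule order_category.intro)
      (auto simp: hom_partial_order idt_closed cmp_closed cmp_idt_left cmp_idt_right cmp_assoc
        intro: cmp_mono)
qed

section \<open>Representables\<close>

lemma hat_obj_simps [simp]:
  "Y \<in> obj K \<Longrightarrow> on_obj (hat_obj K X) Y = hom_poset K X Y"
  "\<lbrakk>Y \<in> obj K; Y' \<in> obj K; g \<in> arr K Y Y'\<rbrakk> \<Longrightarrow>
    on_arr (hat_obj K X) Y Y' g = (\<lambda>h\<in>arr K X Y. cmp K X Y Y' g h)"
  by (simp_all add: hat_obj_def)

lemma hat_simps [simp]: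
  "X \<in> obj K \<Longrightarrow> on_obj (hat K) X = hat_obj K X"
  "\<lbrakk>X \<in> obj K; X' \<in> obj K; f \<in> arr K X X'\<rbrakk> \<Longrightarrow> on_arr (hat K) X X' f = hat_arr K X X' f"
  by (simp_all add: hat_def)

lemma hat_arr_apply [simp]:
  "Z \<in> obj K \<Longrightarrow> hat_arr K X X' f Z = (\<lambda>h\<in>arr K X' Z. cmp K X X' Z h f)"
  by (simp add: hat_arr_def)

text \<open>Passing to the opposite exchanges \<open>F\<close> and \<open>G\<close> in the
  hom-posets, and in composites also the order of the two transformations.\<close>

lemma hat_cat_simps:
  "obj (hat_cat K) = hat_obj K ` obj K \<inter> {F. lax_functor K DCpoV F}"
  "hom_poset (hat_cat K) F G = hom_poset (lax_functor_cat K DCpoV) G F"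
  "idt (hat_cat K) F = (\<lambda>X\<in>obj K. idt DCpoV (on_obj F X))"
  "cmp (hat_cat K) F G H \<tau> \<sigma> = cmp (lax_functor_cat K DCpoV) H G F \<sigma> \<tau>"
  by (simp_all add: hat_cat_def tilde_cat_def)

section \<open>Representable functors and the embedding\<close>

context dcpo_join_category
begin

text \<open>Postcomposition is Scott-continuous by the enrichment. The lax laws hold with equality,
  by the left unit law and associativity, and so reduce to reflexivity.\<close>

lemma lax_functor_hat_obj:
  assumes X: "X \<in> obj C"
  shows "lax_functor C DCpoV (hat_obj C X)"
proof -
  \<comment> \<open>The type is pinned so that the posets in \<open>DCpoV\<close> consist of arrows
    of \<open>C\<close>.\<close>
  interpret D: order_category "DCpoV :: ('b gorder, 'b \<Rightarrow> 'b) ocat"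
    by (rule order_category_DCpoV)
  show ?thesis
  proof (unfold_locales, goal_cases)
    case 1
    show ?case using X by (auto simp: hat_obj_def hom_dcpo_join)
  next
    case 2
    show ?case
      using X
      by (auto simp: hat_obj_def intro!: scott_continuous_restrict cmp_continuous_right)
  next
    case (3 Y Z)
    show ?case
    proof (rule isotoneI, goal_cases)
      case 1
      show ?case using 3 by (intro partial_order.is_weak_partial_order hom_partial_order)
    next
      case 2
      show ?case
        using 3 X
        by (simp add: partial_order.is_weak_partial_order D.hom_partial_order hom_dcpo_join)
    next
      case (3 f g)
      then show ?case
        using \<open>Y \<in> obj C\<close> \<open>Z \<in> obj C\<close> X by (auto intro!: cmp_mono hom_le_refl)
    qed
  next
    case (4 Y)
    then show ?case
      using X by (auto simp: idt_closed cmp_idt_left hom_le_refl)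
  next
    case (5 W Y Z f g)
    then show ?case
      using X by (auto simp: cmp_closed compose_eq cmp_assoc intro!: hom_le_refl)
  qed
qed

text \<open>The square commutes strictly: at \<open>h\<close> its two sides are the two bracketings
  of \<open>g\<close>, \<open>h\<close>, \<open>f\<close>. Continuity of the components is that of
  composition in its other variable.\<close>

lemma hat_arr_oplax:
  assumes X: "X \<in> obj C" and Y: "Y \<in> obj C" and f: "f \<in> arr C X Y"
  shows "hat_arr C X Y f \<in> oplax_transformations C DCpoV (hat_obj C Y) (hat_obj C X)"
proof (rule oplax_transformationI, goal_cases)
  case (1 Z)
  then show ?case
    using assms by (auto intro!: scott_continuous_restrict cmp_continuous_left)
next
  case 2
  show ?case by (simp add: hat_arr_def)
next
  case (3 W Z g)
  then show ?case
    using assms by (auto simp: cmp_closed compose_eq cmp_assoc intro!: hom_le_refl cmp_closed)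
qed

lemma hat_arr_mono:
  assumes "X \<in> obj C" "Y \<in> obj C" "f \<in> arr C X Y" "g \<in> arr C X Y" "arr_le C X Y f g"
  shows "arr_le (hat_cat C) (hat_obj C X) (hat_obj C Y) (hat_arr C X Y f) (hat_arr C X Y g)"
  using assms by (auto simp: hat_cat_simps intro!: cmp_mono hom_le_refl)

lemma order_category_hat_cat: "order_category (hat_cat C)"
  unfolding hat_cat_def tilde_cat_def
  by (intro order_category_full_subcat order_category_op_cat order_category_lax_functor_cat
      order_category_DCpoV order_category_axioms)

lemma hat_obj_in: "X \<in> obj C \<Longrightarrow> hat_obj C X \<in> obj (hat_cat C)"
  by (simp add: hat_cat_simps lax_functor_hat_obj)

text \<open>Precomposition is contravariant and \<open>hat_cat\<close> is an opposite, so the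
  variances cancel. Identities are preserved by the right unit law, composites by
  associativity.\<close>

lemma locally_monotonic_functor_hat: "locally_monotonic_functor C (hat_cat C) (hat C)"
proof -
  interpret H: order_category "hat_cat C" by (rule order_category_hat_cat)
  show ?thesis
  proof (unfold_locales, goal_cases)
    case 1
    show ?case by (auto simp: hat_def hat_obj_in)
  next
    case 2
    show ?case by (auto simp: hat_def hat_cat_simps hat_arr_oplax)
  next
    case (3 X Y)
    then show ?case
      by (intro isotoneI partial_order.is_weak_partial_order hom_partial_order H.hom_partial_order)
        (simp_all add: hat_obj_in hat_arr_mono)
  next
    case (4 X)
    then show ?case
      by (auto simp: hat_cat_simps idt_closed hat_arr_def cmp_idt_right fun_eq_iff)
  next
    case (5 X Y Z f g)
    then show ?case
      by (auto simp: hat_cat_simps cmp_closed hat_arr_def compose_def cmp_assoc fun_eq_iff)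
  qed
qed

section \<open>Evaluation at the identity and the adjunction\<close>

lemma Theta_closed:
  assumes "X \<in> obj C" "Y \<in> obj C"
    and "f \<in> oplax_transformations C DCpoV (hat_obj C Y) (hat_obj C X)"
  shows "Theta C X Y f \<in> arr C X Y"
  using oplax_transformation_closed[OF assms(3), of Y] assms(1,2)
  by (auto simp: Theta_def intro: scott_continuous_closed idt_closed)

text \<open>This is the left unit law; it makes the counit of the adjunction an equality.\<close>

lemma Theta_hat_arr:
  "\<lbrakk>X \<in> obj C; Y \<in> obj C; g \<in> arr C X Y\<rbrakk> \<Longrightarrow> Theta C X Y (hat_arr C X Y g) = g"
  by (simp add: Theta_def idt_closed cmp_idt_left)

text \<open>This is the unit of the adjunction, written out at the component \<open>Z\<close> and
  the argument \<open>h\<close>.\<close>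

lemma oplax_le_Theta:
  assumes "X \<in> obj C" "Y \<in> obj C" "Z \<in> obj C" "h \<in> arr C Y Z"
    and f: "f \<in> oplax_transformations C DCpoV (hat_obj C Y) (hat_obj C X)"
  shows "arr_le C X Z (f Z h) (cmp C X Y Z h (Theta C X Y f))"
  using oplax_transformation_le[OF f, of Y Z h] Theta_closed[OF assms(1,2) f] assms(1-4)
  \<comment> \<open>The oplax square is a pointwise inequality on \<open>arr C Y Y\<close>; at
    \<open>idt C Y\<close> its left side is \<open>f Z\<close> applied to \<open>h\<close> after the
    identity, that is, to \<open>h\<close>.\<close>
  by (auto simp: Theta_def compose_eq idt_closed cmp_idt_right dest!: bspec[of _ _ "idt C Y"])

lemma left_adjoint_Theta:
  assumes X: "X \<in> obj C" and Y: "Y \<in> obj C"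
  shows "left_adjoint (hom_poset (hat_cat C) (hat_obj C X) (hat_obj C Y)) (hom_poset C X Y)
    (Theta C X Y) (on_arr (hat C) X Y)"
proof -
  interpret H: order_category "hat_cat C" by (rule order_category_hat_cat)
  show ?thesis
    unfolding left_adjoint_def
  proof (intro galois_connection.intro connection.intro galois_connection_axioms.intro, goal_cases)
    case 1
    show ?case using X Y by (simp add: H.hom_partial_order hat_obj_in)
  next
    case 2
    show ?case using X Y by (simp add: hom_partial_order)
  next
    case 3
    show ?case using X Y by (simp add: hat_cat_simps Theta_closed)
  next
    case 4
    show ?case using X Y by (simp add: hat_cat_simps hat_arr_oplax)
  next
    case (5 f g)
    then have f: "f \<in> oplax_transformations C DCpoV (hat_obj C Y) (hat_obj C X)"
      and g: "g \<in> arr C X Y"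
      by (simp_all add: hat_cat_simps)
    have \<Theta>: "Theta C X Y f \<in> arr C X Y" using X Y f by (rule Theta_closed)
    \<comment> \<open>The right-hand side is \<open>f \<le> hat_arr C X Y g\<close> in the hom-poset
      of \<open>hat_cat\<close>, unfolded through both pointwise orders. Monotonicity of both maps
      follows from this equivalence.\<close>
    have "arr_le C X Y (Theta C X Y f) g \<longleftrightarrow>
      (\<forall>Z\<in>obj C. \<forall>h\<in>arr C Y Z. arr_le C X Z (f Z h) (cmp C X Y Z h g))" (is "?L \<longleftrightarrow> ?R")
    proof
      assume L: ?L
      show ?R
      proof (intro ballI)
        fix Z h assume Z: "Z \<in> obj C" and h: "h \<in> arr C Y Z"
        have "f Z h \<in> arr C X Z"
          using oplax_transformation_closed[OF f Z] X Y Z h by (auto intro: scott_continuous_closed)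
        moreover have "arr_le C X Z (cmp C X Y Z h (Theta C X Y f)) (cmp C X Y Z h g)"
          using X Y Z h \<Theta> g L by (intro cmp_mono hom_le_refl)
        ultimately show "arr_le C X Z (f Z h) (cmp C X Y Z h g)"
          using X Y Z h \<Theta> g oplax_le_Theta[OF X Y Z h f]
          by (meson hom_le_trans cmp_closed)
      qed
    next
      assume ?R
      \<comment> \<open>Specialising to \<open>Z = Y\<close> and \<open>h = idt C Y\<close> recovers
        \<open>Theta\<close> on the left and \<open>g\<close> on the right.\<close>
      then have "arr_le C X Y (f Y (idt C Y)) (cmp C X Y Y (idt C Y) g)"
        using Y idt_closed by blast
      then show ?L
        using X Y g by (simp add: Theta_def cmp_idt_left)
    qed
    then show ?case using X Y g by (simp add: hat_cat_simps)
  qed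
qed

lemma faithful_hat: "faithful C (hat C)"
  unfolding faithful_def
proof (intro ballI inj_onI)
  fix X Y f g
  assume "X \<in> obj C" "Y \<in> obj C" "f \<in> arr C X Y" "g \<in> arr C X Y"
    and "on_arr (hat C) X Y f = on_arr (hat C) X Y g"
  then show "f = g" by (metis hat_simps(2) Theta_hat_arr)
qed

end

theorem theorem4p2:
  fixes K :: "('o, 'm) ocat"
  assumes "dcpo_join_category K"
  shows "(\<forall>X\<in>obj K. \<forall>Y\<in>obj K.
            left_adjoint (hom_poset (hat_cat K) (hat_obj K X) (hat_obj K Y)) (hom_poset K X Y)
              (Theta K X Y) (on_arr (hat K) X Y))
         \<and> locally_reflective_embedding K (hat_cat K) (hat K)"
proof -
  interpret dcpo_join_category K by fact
  show ?thesis
    unfolding locally_reflective_embedding_def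
    \<comment> \<open>\<open>Theta K X Y\<close> witnesses the existentially quantified left
      adjoint.\<close>
    by (auto simp: locally_monotonic_functor_hat faithful_hat intro: left_adjoint_Theta)
qed

end
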